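(* Fix $\alpha,G>0$ and an integer $N\ge 8$. For every randomized method using at most $\lfloor N/(128\log(2N))\rfloor$ calls to a $1$-fold sparse projection oracle, there exists an instance in dimension $n=2N$ with compact (convex) feasible set $\mathcal K\subset\mathbb R^{2N}$, an $\alpha$-strongly convex objective $f:\mathbb R^{2N}\to\mathbb R$ whose feasible subgradients have norm at most $G$ (i.e. $\|g\|\le G$ for all $w\in\mathcal K$, $g\in\partial f(w)$), and a unique minimizer $w^*$ of $f$ over $\mathcal K$, which is a vertex of $\mathcal K$, such that, writing $F=f+I_{\mathcal K}$, the output $\widehat w$ of the method satisfies $$ \mathbb E\left[F(\widehat w)-F(w^* )\right]\ \ge\ \frac{G^2}{128\,\alpha N}, $$ where the expectation is over the method's internal randomness. Arbitrarily many first-order calls to $f$ between sparse projections are allowed. Consequently, there is a universal constant $c_0>0$ such that, whenever $G^2/(\alpha\epsilon)$ is sufficiently large, every randomized method that guarantees expected error at most $\epsilon$ on all such instances (with $1$-fold sparse projection oracle and a single-vertex optimal solution) requires at least $$ c_0\,\frac{G^2}{\alpha\epsilon\,\log\left(2G^2/(\alpha\epsilon)\right)} $$ sparse projections in the worst case.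
   Context: Problem: minimize $F=f+I_{\mathcal K}$, where $f$ is convex, $\mathcal K\subset\mathbb R^n$ is convex and compact with set of vertices (extreme points) $\mathcal V$, and $I_{\mathcal K}$ is $0$ on $\mathcal K$ and $+\infty$ outside; thus infeasible outputs have infinite error $F(\widehat w)-F(w^* )$. Norms are Euclidean and $\log$ is the natural logarithm. $1$-fold sparse projection oracle (when the optimal solution is a single vertex): given $y\in\mathbb R^n$, it outputs a point of $\arg\min_{z\in\mathcal V}\|z-y\|$, with ties broken by a deterministic rule that is part of the instance. Access model: the method is not given an explicit description of $\mathcal K$; its only access to $\mathcal K$ is through the $1$-fold sparse projection oracle. It may otherwise perform arbitrary computations and make arbitrarily many calls to a first-order oracle for $f$ (at a query $w$ it returns $f(w)$ and a subgradient of $f$ at $w$ chosen by a deterministic rule that is part of the instance). Only sparse-projection calls are counted. A randomized method may use internal random bits (independent of the instance) to choose its queries and its output $\widehat w\in\mathbb R^n$; the bound on the number of sparse-projection calls must hold for every realization of its internal randomness. The instance in the statement may depend on the method but not on its random bits. Expected error means $\mathbb E[F(\widehat w)-F(w^* )]$. *)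

theory Defs
  imports "HOL-Probability.Probability"
begin

text \<open>
  The dimension has to be quantified inside a formula, so it cannot be a type. All the spaces
  $\mathbb{R}^n$ are therefore realised inside one real inner product space, the finitely supported
  sequences with the standard inner product: $\mathbb{R}^n$ is the subspace of the sequences
  vanishing from index \<open>n\<close> on. The library notions of norm, convexity, compactness and extreme
  point, applied to subsets of this subspace, are those of Euclidean space.
\<close>

typedef point = "{x :: nat \<Rightarrow> real. finite {i. x i \<noteq> 0}}"
  morphisms coord Point
  by (rule exI[of _ "\<lambda>_. 0"]) simp

setup_lifting type_definition_point

lemma finite_support: "finite {i. coord x i \<noteq> 0}"
  using coord[of x] by simp

lemma point_eqI: "(\<And>i. coord x i = coord y i) \<Longrightarrow> x = y"
  by (simp add: coord_inject[symmetric] fun_eq_iff)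

instantiation point :: real_vector
begin

lift_definition zero_point :: point is "\<lambda>_. 0" by simp

lift_definition plus_point :: "point \<Rightarrow> point \<Rightarrow> point" is "\<lambda>x y i. x i + y i"
proof -
  fix x y :: "nat \<Rightarrow> real"
  assume "finite {i. x i \<noteq> 0}" "finite {i. y i \<noteq> 0}"
  then show "finite {i. x i + y i \<noteq> 0}"
    by (rule finite_subset[OF _ finite_UnI, rotated]) auto
qed

lift_definition uminus_point :: "point \<Rightarrow> point" is "\<lambda>x i. - x i" by simp

lift_definition minus_point :: "point \<Rightarrow> point \<Rightarrow> point" is "\<lambda>x y i. x i - y i"
proof -
  fix x y :: "nat \<Rightarrow> real"
  assume "finite {i. x i \<noteq> 0}" "finite {i. y i \<noteq> 0}"
  then show "finite {i. x i - y i \<noteq> 0}"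
    by (rule finite_subset[OF _ finite_UnI, rotated]) auto
qed

lift_definition scaleR_point :: "real \<Rightarrow> point \<Rightarrow> point" is "\<lambda>c x i. c * x i"
  by (rule finite_subset[rotated]) auto

instance
  by standard (transfer, simp add: fun_eq_iff algebra_simps)+

end

lemmas coord_simps [simp] =
  zero_point.rep_eq plus_point.rep_eq uminus_point.rep_eq minus_point.rep_eq scaleR_point.rep_eq

instantiation point :: real_inner
begin

definition inner_point :: "point \<Rightarrow> point \<Rightarrow> real"
  where "inner_point x y = (\<Sum>i | coord x i \<noteq> 0. coord x i * coord y i)"

definition norm_point :: "point \<Rightarrow> real"
  where "norm_point x = sqrt (inner x x)"

definition dist_point :: "point \<Rightarrow> point \<Rightarrow> real"
  where "dist_point x y = norm (x - y)"

definition sgn_point :: "point \<Rightarrow> point"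
  where "sgn_point x = x /\<^sub>R norm x"

definition uniformity_point :: "(point \<times> point) filter"
  where "uniformity_point = (INF e\<in>{0<..}. principal {(x, y). dist x y < e})"

definition open_point :: "point set \<Rightarrow> bool"
  where "open_point U \<longleftrightarrow> (\<forall>x\<in>U. \<forall>\<^sub>F (x', y) in uniformity. x' = x \<longrightarrow> y \<in> U)"

lemma inner_point_superset:
  assumes "finite S" "{i. coord x i \<noteq> 0} \<subseteq> S"
  shows "inner x y = (\<Sum>i\<in>S. coord x i * coord y i)"
  unfolding inner_point_def using assms by (intro sum.mono_neutral_left) auto

instance
proof
  fix x y z :: point and r :: real
  define S where "S = {i. coord x i \<noteq> 0} \<union> {i. coord y i \<noteq> 0}"
  have fin: "finite S" by (simp add: S_def finite_support)
  have X: "inner x w = (\<Sum>i\<in>S. coord x i * coord w i)" for w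
    by (rule inner_point_superset[OF fin]) (auto simp: S_def)
  have Y: "inner y w = (\<Sum>i\<in>S. coord y i * coord w i)" for w
    by (rule inner_point_superset[OF fin]) (auto simp: S_def)
  show "inner x y = inner y x"
    by (simp add: X Y mult.commute)
  have "inner (x + y) z = (\<Sum>i\<in>S. coord (x + y) i * coord z i)"
    by (rule inner_point_superset[OF fin]) (auto simp: S_def)
  then show "inner (x + y) z = inner x z + inner y z"
    by (simp add: X Y algebra_simps sum.distrib)
  have "inner (r *\<^sub>R x) y = (\<Sum>i\<in>S. coord (r *\<^sub>R x) i * coord y i)"
    by (rule inner_point_superset[OF fin]) (auto simp: S_def)
  then show "inner (r *\<^sub>R x) y = r * inner x y"
    by (simp add: X sum_distrib_left mult.assoc)
  show "0 \<le> inner x x"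
    by (simp add: inner_point_def sum_nonneg)
  show "inner x x = 0 \<longleftrightarrow> x = 0"
  proof
    assume "inner x x = 0"
    then have "coord x i = 0" if "i \<in> S" for i
      using that fin by (simp add: X sum_nonneg_eq_0_iff)
    then show "x = 0"
      by (intro point_eqI) (auto simp: S_def)
  qed (simp add: inner_point_def)
qed (simp_all add: norm_point_def dist_point_def sgn_point_def uniformity_point_def open_point_def)

end

definition Rn :: "nat \<Rightarrow> point set"
  where "Rn n = {x. \<forall>i\<ge>n. coord x i = 0}"

lemma inner_Rn: "x \<in> Rn n \<Longrightarrow> inner x y = (\<Sum>i<n. coord x i * coord y i)"
  by (rule inner_point_superset) (auto simp: Rn_def not_le[symmetric])

lemma norm_Rn: "x \<in> Rn n \<Longrightarrow> norm x = sqrt (\<Sum>i<n. (coord x i)\<^sup>2)"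
  by (simp add: norm_point_def inner_Rn power2_eq_square)

lemma subspace_Rn: "subspace (Rn n)"
  by (auto simp: subspace_def Rn_def)

definition strongly_convex_on :: "point set \<Rightarrow> real \<Rightarrow> (point \<Rightarrow> real) \<Rightarrow> bool"
  where "strongly_convex_on S \<alpha> f \<longleftrightarrow> convex S \<and>
    (\<forall>x\<in>S. \<forall>y\<in>S. \<forall>t\<in>{0..1}.
      f ((1 - t) *\<^sub>R x + t *\<^sub>R y)
        \<le> (1 - t) * f x + t * f y - \<alpha> / 2 * t * (1 - t) * (norm (x - y))\<^sup>2)"

definition subdifferential :: "nat \<Rightarrow> (point \<Rightarrow> real) \<Rightarrow> point \<Rightarrow> point set"
  where "subdifferential n f w = {g \<in> Rn n. \<forall>z\<in>Rn n. f w + inner g (z - w) \<le> f z}"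

text \<open>
  The two rules are the deterministic choices made by the sparse projection oracle (tie-breaking)
  and by the first-order oracle (selection of a subgradient).
\<close>

record problem =
  feasible :: "point set"
  objective :: "point \<Rightarrow> real"
  projection_rule :: "point \<Rightarrow> point"
  subgradient_rule :: "point \<Rightarrow> point"

definition vertices :: "problem \<Rightarrow> point set"
  where "vertices I = {v. v extreme_point_of feasible I}"

definition sparse_projection_rule :: "nat \<Rightarrow> problem \<Rightarrow> bool"
  where "sparse_projection_rule n I \<longleftrightarrow>
    (\<forall>y\<in>Rn n. is_arg_min (\<lambda>z. norm (z - y)) (\<lambda>z. z \<in> vertices I) (projection_rule I y))"

definition unique_minimizer :: "problem \<Rightarrow> point \<Rightarrow> bool"
  where "unique_minimizer I w \<longleftrightarrow>
    (\<forall>z. is_arg_min (objective I) (\<lambda>z. z \<in> feasible I) z \<longleftrightarrow> z = w)"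

definition problem_instance :: "real \<Rightarrow> real \<Rightarrow> nat \<Rightarrow> problem \<Rightarrow> point \<Rightarrow> bool"
  where "problem_instance \<alpha> G n I wstar \<longleftrightarrow>
    feasible I \<subseteq> Rn n \<and> convex (feasible I) \<and> compact (feasible I) \<and>
    strongly_convex_on (Rn n) \<alpha> (objective I) \<and>
    (\<forall>w\<in>feasible I. \<forall>g\<in>subdifferential n (objective I) w. norm g \<le> G) \<and>
    sparse_projection_rule n I \<and>
    (\<forall>w\<in>Rn n. subgradient_rule I w \<in> subdifferential n (objective I) w) \<and>
    unique_minimizer I wstar \<and> wstar \<in> vertices I"

definition extended_objective :: "problem \<Rightarrow> point \<Rightarrow> ereal"
  where "extended_objective I w = ereal (objective I w) + (if w \<in> feasible I then 0 else \<infinity>)"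

text \<open>
  A deterministic method is a map from the answers received so far to the next action. The queries
  need not be recorded in the history, since the method can recompute them from the answers.
\<close>

datatype action =
  Project (action_point: point)
| First_Order (action_point: point)
| Output (action_point: point)

datatype answer =
  Projection point
| Value_Subgradient real point

type_synonym strategy = "answer list \<Rightarrow> action"

definition step :: "strategy \<Rightarrow> problem \<Rightarrow> answer list \<Rightarrow> answer list"
  where "step m I h = (case m h of
      Project y \<Rightarrow> h @ [Projection (projection_rule I y)]
    | First_Order w \<Rightarrow> h @ [Value_Subgradient (objective I w) (subgradient_rule I w)]
    | Output w \<Rightarrow> h)"

definition transcript :: "strategy \<Rightarrow> problem \<Rightarrow> nat \<Rightarrow> answer list"
  where "transcript m I t = (step m I ^^ t) []"

definition outputs :: "strategy \<Rightarrow> problem \<Rightarrow> point \<Rightarrow> bool"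
  where "outputs m I w \<longleftrightarrow> (\<exists>t. m (transcript m I t) = Output w)"

definition the_output :: "strategy \<Rightarrow> problem \<Rightarrow> point"
  where "the_output m I = (THE w. outputs m I w)"

definition projection_calls :: "strategy \<Rightarrow> problem \<Rightarrow> nat \<Rightarrow> nat"
  where "projection_calls m I t =
    length (filter (\<lambda>a. \<exists>v. a = Projection v) (transcript m I t))"

text \<open>
  The internal randomness is an infinite bit sequence. Its law is an arbitrary probability measure,
  independent fair bits being a special case. The seed type is kept concrete because a constant
  that is existentially quantified before the methods could otherwise depend on it.
  Measurability is only required of the output.
\<close>

type_synonym seed = "nat \<Rightarrow> bool"

definition randomized_method ::
    "real \<Rightarrow> real \<Rightarrow> nat \<Rightarrow> seed measure \<Rightarrow> (seed \<Rightarrow> strategy) \<Rightarrow> bool"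
  where "randomized_method \<alpha> G n P M \<longleftrightarrow>
    prob_space P \<and>
    (\<forall>\<omega>\<in>space P. \<forall>h. action_point (M \<omega> h) \<in> Rn n) \<and>
    (\<forall>I wstar. problem_instance \<alpha> G n I wstar \<longrightarrow>
      (\<forall>\<omega>\<in>space P. \<exists>w. outputs (M \<omega>) I w) \<and>
      (\<lambda>\<omega>. the_output (M \<omega>) I) \<in> borel_measurable P)"

definition expected_error ::
    "seed measure \<Rightarrow> (seed \<Rightarrow> strategy) \<Rightarrow> problem \<Rightarrow> point \<Rightarrow> ennreal"
  where "expected_error P M I wstar =
    (\<integral>\<^sup>+ \<omega>. e2ennreal (extended_objective I (the_output (M \<omega>) I)
      - extended_objective I wstar) \<partial>P)"

end

theory Submission
  imports Defs
begin

text \<open>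
  All instances share the objective \<open>c / sqrt N * (\<Sum>i<N. \<bar>x i\<bar>) + \<alpha> / 2 * \<parallel>x\<parallel>\<^sup>2\<close>. An instance hides a
  sign pattern on the first \<open>N\<close> coordinates and an index \<open>j\<close> among the last \<open>N\<close>. Its optimum is the
  apex \<open>s e(N + j)\<close>; the other vertices, the decoys, are
  \<open>s / sqrt 2 * (sign i) e(i) + s / 2 * (e(N + k) + e(N + l))\<close> with \<open>k \<noteq> l\<close>, and lie on the same sphere.
  A projection query whose first block agrees in sign with the pattern somewhere returns a
  decoy for all but at most one \<open>j\<close>, so such queries test the indices one at a time. A query that
  disagrees everywhere determines the pattern, while a decoy answer takes at most \<open>2 N\<close> values once
  the pair \<open>(k, l)\<close>, which depends on the query only, is discarded; hence at most \<open>(2 N) ^ T\<close> of the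
  \<open>2 ^ N\<close> patterns can ever be guessed. As long as the apex is not hit, the output does not depend
  on \<open>j\<close>, so for all but one \<open>j\<close> it is infeasible or puts at least half of its weight on decoys. On
  the convex hull of the decoys the first block has l1 norm at least \<open>s / sqrt 2\<close> (the hidden signs
  cohere), which makes them worse than the apex by a multiple of \<open>G\<^sup>2 / (\<alpha> N)\<close>. Averaging over the
  finitely many instances handles the randomness of the method.
\<close>

section \<open>Points and norms\<close>

lift_definition unit_point :: "nat \<Rightarrow> point" is "\<lambda>k i. if i = k then 1 else 0" by simp

lemma coord_unit_point [simp]: "coord (unit_point k) i = (if i = k then 1 else 0)"
  by (simp add: unit_point.rep_eq)

lemma inner_unit_point [simp]: "inner (unit_point k) x = coord x k"
  by (subst inner_point_superset[of "{k}"]) auto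

lemma inner_unit_point_right [simp]: "inner x (unit_point k) = coord x k"
  by (simp add: inner_commute[of x])

lemma coord_sum: "coord (\<Sum>a\<in>A. F a) i = (\<Sum>a\<in>A. coord (F a) i)"
  by (simp only: inner_unit_point[symmetric] inner_sum_right)

lemma unit_point_in_Rn: "k < n \<Longrightarrow> unit_point k \<in> Rn n"
  by (simp add: Rn_def)

text \<open>Expanding the squares cancels \<open>inner u u\<close> against \<open>inner v v\<close>.
  As all vertices of an instance have norm \<open>s\<close>, projecting onto them means maximising a
  linear functional.\<close>

lemma norm_le_iff_inner:
  fixes u v y :: "'a::real_inner"
  assumes "norm u = norm v"
  shows "norm (u - y) \<le> norm (v - y) \<longleftrightarrow> inner v y \<le> inner u y"
proof -
  have "inner u u = inner v v"
    using assms by (simp add: norm_eq)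
  then show ?thesis
    by (simp add: norm_le inner_simps inner_commute)
qed

lemma norm_convex_combination:
  fixes x y :: "'a::real_inner"
  shows "(norm ((1 - t) *\<^sub>R x + t *\<^sub>R y))\<^sup>2
    = (1 - t) * (norm x)\<^sup>2 + t * (norm y)\<^sup>2 - t * (1 - t) * (norm (x - y))\<^sup>2"
  unfolding power2_norm_eq_inner by (simp add: inner_simps inner_commute algebra_simps)

text \<open>Strict convexity of the ball: by \<open>norm_convex_combination\<close>, a proper convex
  combination of two distinct points of norm at most \<open>r\<close> has norm below
  \<open>r\<close>.\<close>

lemma extreme_point_of_sphere:
  fixes v :: "'a::real_inner"
  assumes "v \<in> S" "norm v = r" "\<And>w. w \<in> S \<Longrightarrow> norm w \<le> r"
  shows "v extreme_point_of S"
  unfolding extreme_point_of_def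
proof (intro conjI ballI notI)
  fix a b assume ab: "a \<in> S" "b \<in> S" and "v \<in> open_segment a b"
  then obtain t where t: "0 < t" "t < 1" "v = (1 - t) *\<^sub>R a + t *\<^sub>R b" "a \<noteq> b"
    by (auto simp: in_segment)
  have r: "0 \<le> r"
    using assms(2) norm_ge_zero by metis
  have "(norm v)\<^sup>2 = (1 - t) * (norm a)\<^sup>2 + t * (norm b)\<^sup>2 - t * (1 - t) * (norm (a - b))\<^sup>2"
    unfolding t(3) by (rule norm_convex_combination)
  moreover have "(1 - t) * (norm a)\<^sup>2 + t * (norm b)\<^sup>2 \<le> (1 - t) * r\<^sup>2 + t * r\<^sup>2"
    using assms(3)[OF ab(1)] assms(3)[OF ab(2)] t by (intro add_mono mult_left_mono power_mono) auto
  moreover have "0 < t * (1 - t) * (norm (a - b))\<^sup>2"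
    using t by simp
  ultimately have "(norm v)\<^sup>2 < r\<^sup>2"
    by (simp add: algebra_simps)
  then show False
    using assms(2) by simp
qed (fact assms(1))

definition spin :: "nat set \<Rightarrow> nat \<Rightarrow> real"
  where "spin S i = (if i \<in> S then 1 else - 1)"

lemma spin_square [simp]: "spin S i * spin S i = 1"
  by (simp add: spin_def)

lemma inner_unit_sum: "inner (\<Sum>i<N. c i *\<^sub>R unit_point i) w = (\<Sum>i<N. c i * coord w i)"
  by (simp add: inner_sum_left)

lemma coord_unit_sum:
  "coord (\<Sum>i<N. c i *\<^sub>R unit_point i) m = (if m < N then c m else 0)"
proof -
  have "coord (\<Sum>i<N. c i *\<^sub>R unit_point i) m = (\<Sum>i<N. if i = m then c m else 0)"
    unfolding coord_sum by (intro sum.cong) auto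
  then show ?thesis
    by simp
qed

text \<open>Cauchy-Schwarz against the sign vector of \<open>w\<close>, whose norm is at most
  \<open>sqrt N\<close>.\<close>

lemma sum_abs_coord_le: "(\<Sum>i<N. \<bar>coord w i\<bar>) \<le> sqrt (real N) * norm w"
proof -
  define v where "v = (\<Sum>i<N. sgn (coord w i) *\<^sub>R unit_point i)"
  have "(norm v)\<^sup>2 = (\<Sum>i<N. sgn (coord w i) * coord v i)"
    unfolding power2_norm_eq_inner by (subst v_def) (simp add: inner_unit_sum)
  also have "\<dots> \<le> (\<Sum>i<N. 1)"
    by (intro sum_mono) (auto simp: v_def coord_unit_sum sgn_if)
  finally have "norm v \<le> sqrt (real N)"
    by (intro real_le_rsqrt) simp
  moreover have "(\<Sum>i<N. \<bar>coord w i\<bar>) = inner v w"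
    by (simp add: v_def inner_unit_sum abs_sgn mult.commute)
  moreover have "inner v w \<le> norm v * norm w"
    by (rule norm_cauchy_schwarz)
  ultimately show ?thesis
    by (smt (verit) mult_right_mono norm_ge_zero)
qed

section \<open>The hard instances\<close>

locale hard_family =
  fixes \<alpha> G :: real and N :: nat
  assumes alpha_pos: "0 < \<alpha>" and G_pos: "0 < G" and N_ge: "8 \<le> N"
begin

text \<open>The common norm of all vertices. At this scale a unit of decoy weight costs at least
  G^2/(8 alpha N) in the l1 term, twice the alpha s^2 = G^2/(16 alpha N) that bounds the saving in
  the quadratic term.\<close>

definition s :: real
  where "s = G / (4 * \<alpha> * sqrt (real N))"

text \<open>By \<open>sum_abs_coord_le\<close> the l1 term has Lipschitz constant 3/4 G. This leaves
  room under \<open>G\<close> for the gradient of the quadratic term, of norm at most G/8 on the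
  ball of radius \<open>s\<close>.\<close>

definition f :: "point \<Rightarrow> real"
  where "f w = 3 * G / (4 * sqrt (real N)) * (\<Sum>i<N. \<bar>coord w i\<bar>) + \<alpha> / 2 * (norm w)\<^sup>2"

definition subgrad :: "point \<Rightarrow> point"
  where "subgrad w =
    (3 * G / (4 * sqrt (real N))) *\<^sub>R (\<Sum>i<N. sgn (coord w i) *\<^sub>R unit_point i) + \<alpha> *\<^sub>R w"

text \<open>The squared coefficients sum to s^2, so decoys and apices share one sphere. In the
  second block a decoy is the midpoint of two apices.\<close>

definition decoy :: "nat set \<Rightarrow> nat \<Rightarrow> nat \<Rightarrow> nat \<Rightarrow> point"
  where "decoy S i k l =
    (s / sqrt 2 * spin S i) *\<^sub>R unit_point i + (s / 2) *\<^sub>R (unit_point (N + k) + unit_point (N + l))"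

definition decoys :: "nat set \<Rightarrow> point set"
  where "decoys S = {decoy S i k l | i k l. i < N \<and> k < N \<and> l < N \<and> k \<noteq> l}"

definition apex :: "nat \<Rightarrow> point"
  where "apex j = s *\<^sub>R unit_point (N + j)"

definition body :: "nat set \<Rightarrow> nat \<Rightarrow> point set"
  where "body S j = convex hull (insert (apex j) (decoys S))"

definition best_axis :: "nat set \<Rightarrow> point \<Rightarrow> nat"
  where "best_axis S y = (SOME i. i < N \<and> (\<forall>i'<N. spin S i' * coord y i' \<le> spin S i * coord y i))"

text \<open>The sign pattern does not enter: for a given query the preferred pair is the same in all
  instances.\<close>

definition best_pair :: "point \<Rightarrow> nat \<times> nat"
  where "best_pair y = (SOME (k, l). k < N \<and> l < N \<and> k \<noteq> l \<and>
    (\<forall>k'<N. \<forall>l'<N. k' \<noteq> l' \<longrightarrow>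
      coord y (N + k') + coord y (N + l') \<le> coord y (N + k) + coord y (N + l)))"

definition best_decoy :: "nat set \<Rightarrow> point \<Rightarrow> point"
  where "best_decoy S y = decoy S (best_axis S y) (fst (best_pair y)) (snd (best_pair y))"

text \<open>The inequality is strict, so a tie is resolved in favour of the decoy and conceals the
  apex.\<close>

definition hits :: "nat set \<Rightarrow> nat \<Rightarrow> point \<Rightarrow> bool"
  where "hits S j y \<longleftrightarrow> inner (best_decoy S y) y < inner (apex j) y"

definition inst :: "nat set \<Rightarrow> nat \<Rightarrow> problem"
  where "inst S j = \<lparr>feasible = body S j, objective = f,
    projection_rule = (\<lambda>y. if hits S j y then apex j else best_decoy S y),
    subgradient_rule = subgrad\<rparr>"

text \<open>Not an actual instance: it simulates the answers as long as the hidden apex is not hit.\<close>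

definition shadow :: "nat set \<Rightarrow> problem"
  where "shadow S = \<lparr>feasible = {}, objective = f,
    projection_rule = best_decoy S, subgradient_rule = subgrad\<rparr>"

section \<open>Geometry of the vertices and of the projection oracle\<close>

lemma s_pos: "0 < s"
  using alpha_pos G_pos N_ge by (simp add: s_def)

lemma s_le: "\<alpha> * s \<le> G / 8"
proof -
  have "sqrt 4 \<le> sqrt (real N)"
    using N_ge by (intro real_sqrt_le_mono) simp
  then have "2 \<le> sqrt (real N)"
    by simp
  then have "G / (4 * sqrt (real N)) \<le> G / (4 * 2)"
    using G_pos N_ge by (intro divide_left_mono) auto
  then show ?thesis
    using alpha_pos by (simp add: s_def)
qed

lemma inner_decoy: "inner (decoy S i k l) y
    = s / sqrt 2 * (spin S i * coord y i) + s / 2 * (coord y (N + k) + coord y (N + l))"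
  by (simp add: decoy_def inner_simps algebra_simps)

lemma inner_apex: "inner (apex j) y = s * coord y (N + j)"
  by (simp add: apex_def)

lemma norm_apex: "norm (apex j) = s"
  using s_pos by (simp add: apex_def norm_eq_sqrt_inner)

lemma coord_decoy:
  assumes "i < N" "k \<noteq> l"
  shows "coord (decoy S i k l) m
    = (if m = i then s / sqrt 2 * spin S i else if m = N + k \<or> m = N + l then s / 2 else 0)"
  using assms by (auto simp: decoy_def)

lemma norm_decoy:
  assumes "v \<in> decoys S"
  shows "norm v = s"
proof -
  obtain i k l where v: "v = decoy S i k l" "i < N" "k < N" "l < N" "k \<noteq> l"
    using assms by (auto simp: decoys_def)
  define a where "a = s / sqrt 2"
  have a: "a * a = s\<^sup>2 / 2"
    by (simp add: a_def power2_eq_square)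
  have "inner v v = a * (spin S i * coord v i) + s / 2 * (coord v (N + k) + coord v (N + l))"
    unfolding v(1) inner_decoy a_def ..
  also have "coord v i = a * spin S i"
    unfolding v(1) coord_decoy[OF v(2,5)] a_def by simp
  also have "coord v (N + k) = s / 2"
    unfolding v(1) coord_decoy[OF v(2,5)] using v(2) by simp
  also have "coord v (N + l) = s / 2"
    unfolding v(1) coord_decoy[OF v(2,5)] using v(2) by simp
  also have "a * (spin S i * (a * spin S i)) = a * a * (spin S i * spin S i)"
    by (simp only: mult_ac)
  finally have "inner v v = s\<^sup>2"
    by (simp add: a power2_eq_square)
  then show ?thesis
    using s_pos by (simp add: norm_eq_sqrt_inner)
qed

lemma best_axis:
  "best_axis S y < N" "i < N \<Longrightarrow> spin S i * coord y i \<le> spin S (best_axis S y) * coord y (best_axis S y)"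
proof -
  let ?A = "{..<N}" and ?g = "\<lambda>i. spin S i * coord y i"
  have "?A \<noteq> {}"
    using N_ge by (auto simp: lessThan_empty_iff)
  then have "Max (?g ` ?A) \<in> ?g ` ?A"
    by (intro Max_in) auto
  then obtain m where m: "m \<in> ?A" "Max (?g ` ?A) = ?g m"
    by blast
  have "?g i \<le> ?g m" if "i < N" for i
    unfolding m(2)[symmetric] using that by (intro Max_ge) auto
  then have "m < N \<and> (\<forall>i'<N. ?g i' \<le> ?g m)"
    using m(1) by simp
  then have *: "best_axis S y < N \<and> (\<forall>i'<N. ?g i' \<le> ?g (best_axis S y))"
    unfolding best_axis_def by (rule someI)
  then show "best_axis S y < N" "i < N \<Longrightarrow> ?g i \<le> ?g (best_axis S y)"
    by auto
qed

lemma best_pair: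
  assumes "best_pair y = (k, l)"
  shows "k < N" "l < N" "k \<noteq> l"
    "k' < N \<Longrightarrow> l' < N \<Longrightarrow> k' \<noteq> l' \<Longrightarrow>
      coord y (N + k') + coord y (N + l') \<le> coord y (N + k) + coord y (N + l)"
proof -
  let ?A = "{(k, l). k < N \<and> l < N \<and> k \<noteq> l}" and ?g = "\<lambda>(k, l). coord y (N + k) + coord y (N + l)"
  have fin: "finite ?A"
    by (rule finite_subset[of _ "{..<N} \<times> {..<N}"]) auto
  have "(0, 1) \<in> ?A"
    using N_ge by simp
  then have "?A \<noteq> {}"
    by blast
  then obtain m where m: "m \<in> ?A" "?g m = Max (?g ` ?A)"
    using Max_in[of "?g ` ?A"] fin by (metis (no_types, lifting) finite_imageI image_iff image_is_empty)
  have "?g p \<le> ?g m" if "p \<in> ?A" for p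
    unfolding m(2) using that fin by (intro Max_ge) auto
  then have "\<exists>p. case p of (k, l) \<Rightarrow> k < N \<and> l < N \<and> k \<noteq> l \<and>
    (\<forall>k'<N. \<forall>l'<N. k' \<noteq> l' \<longrightarrow>
      coord y (N + k') + coord y (N + l') \<le> coord y (N + k) + coord y (N + l))"
    using m(1) by (intro exI[of _ m]) (auto split: prod.splits)
  from someI_ex[OF this] show "k < N" "l < N" "k \<noteq> l"
    "k' < N \<Longrightarrow> l' < N \<Longrightarrow> k' \<noteq> l' \<Longrightarrow>
      coord y (N + k') + coord y (N + l') \<le> coord y (N + k) + coord y (N + l)"
    unfolding best_pair_def[symmetric] assms by auto
qed

lemma best_decoy_in: "best_decoy S y \<in> decoys S"
  using best_axis(1)[of S y] best_pair[of y "fst (best_pair y)" "snd (best_pair y)"]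
  by (auto simp: best_decoy_def decoys_def)

text \<open>By \<open>inner_decoy\<close> the functional splits into a term in \<open>i\<close> and
  a term in the pair, with positive factors, so axis and pair can be maximised separately.\<close>

lemma best_decoy_max:
  assumes "v \<in> decoys S"
  shows "inner v y \<le> inner (best_decoy S y) y"
proof -
  obtain i k l where v: "v = decoy S i k l" "i < N" "k < N" "l < N" "k \<noteq> l"
    using assms by (auto simp: decoys_def)
  show ?thesis
    unfolding v(1) best_decoy_def inner_decoy
    using v best_axis(2)[of i S y] best_pair(4)[of y "fst (best_pair y)" "snd (best_pair y)" k l]
    by (intro add_mono[OF mult_left_mono mult_left_mono]) (auto simp: s_pos less_imp_le)
qed

text \<open>A query that hits both \<open>j\<close> and \<open>k\<close> would be beaten by the decoy pointing to the midpoint of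
  their apices.\<close>

lemma hits_unique:
  assumes "hits S j y" "hits S k y" "j < N" "k < N" "i < N" "0 \<le> spin S i * coord y i"
  shows "j = k"
proof (rule ccontr)
  assume "j \<noteq> k"
  then have "decoy S i j k \<in> decoys S"
    using assms by (auto simp: decoys_def)
  then have "inner (decoy S i j k) y \<le> inner (best_decoy S y) y"
    by (rule best_decoy_max)
  then have "inner (decoy S i j k) y < s * coord y (N + j)" "inner (decoy S i j k) y < s * coord y (N + k)"
    using assms(1,2) by (auto simp: hits_def inner_apex)
  moreover have "0 \<le> s / sqrt 2 * (spin S i * coord y i)"
    by (rule mult_nonneg_nonneg[OF _ assms(6)]) (simp add: s_pos less_imp_le)
  ultimately show False
    unfolding inner_decoy by (auto simp: field_simps)
qed

section \<open>Decoy weight and the optimality gap\<close>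

definition slope :: "nat set \<Rightarrow> point"
  where "slope S = (sqrt 2 / s) *\<^sub>R (\<Sum>i<N. spin S i *\<^sub>R unit_point i)"

text \<open>The total weight that a feasible point puts on the decoys.\<close>

definition weight :: "nat set \<Rightarrow> point \<Rightarrow> real"
  where "weight S w = inner (slope S) w"

lemma weight_eq: "weight S w = sqrt 2 / s * (\<Sum>i<N. spin S i * coord w i)"
  by (simp add: weight_def slope_def inner_unit_sum)

lemma weight_apex: "weight S (apex j) = 0"
  by (simp add: weight_eq apex_def)

lemma weight_decoy:
  assumes "v \<in> decoys S"
  shows "weight S v = 1"
proof -
  obtain i k l where v: "v = decoy S i k l" "i < N" "k < N" "l < N" "k \<noteq> l"
    using assms by (auto simp: decoys_def)
  have "(\<Sum>m<N. spin S m * coord v m) = (\<Sum>m<N. if m = i then s / sqrt 2 else 0)"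
    unfolding v(1) coord_decoy[OF v(2,5)] by (intro sum.cong) (auto simp: spin_def)
  also have "\<dots> = s / sqrt 2"
    using v(2) by simp
  finally show ?thesis
    using s_pos by (simp add: weight_eq)
qed

text \<open>The weight is the inner product with the fixed vector \<open>slope S\<close>, so each
  bound describes a half-space, a ball or a subspace. These are convex, hence checking the vertices
  is enough.\<close>

lemma body_bounds:
  assumes "w \<in> body S j" "j < N"
  shows "0 \<le> weight S w" "weight S w \<le> 1" "s * (1 - weight S w) \<le> coord w (N + j)"
    "k < N \<Longrightarrow> k \<noteq> j \<Longrightarrow> coord w (N + k) \<le> s / 2 * weight S w"
    "norm w \<le> s" "w \<in> Rn (2 * N)"
proof -
  let ?H = "{w. inner (slope S) w \<ge> 0} \<inter> {w. inner (slope S) w \<le> 1}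
    \<inter> {w. inner (unit_point (N + j) + s *\<^sub>R slope S) w \<ge> s}
    \<inter> (\<Inter>k\<in>{..<N} - {j}. {w. inner (unit_point (N + k) - (s / 2) *\<^sub>R slope S) w \<le> 0})
    \<inter> cball 0 s \<inter> Rn (2 * N)"
  have "convex ?H"
    by (intro convex_Int convex_INT convex_halfspace_le convex_halfspace_ge convex_cball
        subspace_imp_convex subspace_Rn)
  moreover have "insert (apex j) (decoys S) \<subseteq> ?H"
  proof
    fix v assume "v \<in> insert (apex j) (decoys S)"
    then consider "v = apex j" | "v \<in> decoys S"
      by blast
    then have "0 \<le> weight S v \<and> weight S v \<le> 1 \<and> s \<le> coord v (N + j) + s * weight S v
      \<and> (\<forall>k\<in>{..<N} - {j}. coord v (N + k) - s / 2 * weight S v \<le> 0) \<and> norm v \<le> s \<and> v \<in> Rn (2 * N)"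
    proof cases
      case 1
      have "coord v i = (if i = N + j then s else 0)" for i
        by (simp add: 1 apex_def)
      then show ?thesis
        using weight_apex[of S j] norm_apex[of j] assms(2) 1 by (auto simp: Rn_def)
    next
      case 2
      then obtain i k l where v: "v = decoy S i k l" "i < N" "k < N" "l < N" "k \<noteq> l"
        by (auto simp: decoys_def)
      show ?thesis
        unfolding weight_decoy[OF 2] norm_decoy[OF 2]
        unfolding v(1) coord_decoy[OF v(2,5)] Rn_def mem_Collect_eq
        using s_pos v by auto
    qed
    then show "v \<in> ?H"
      by (simp add: weight_def inner_add_left inner_diff_left)
  qed
  ultimately have "body S j \<subseteq> ?H"
    unfolding body_def by (intro hull_minimal)
  then have w: "w \<in> ?H"
    using assms(1) by blast
  then show "0 \<le> weight S w" "weight S w \<le> 1" "norm w \<le> s" "w \<in> Rn (2 * N)"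
    by (auto simp: weight_def)
  show "s * (1 - weight S w) \<le> coord w (N + j)"
    using w by (auto simp: weight_def inner_simps algebra_simps)
  show "k < N \<Longrightarrow> k \<noteq> j \<Longrightarrow> coord w (N + k) \<le> s / 2 * weight S w"
    using w by (auto simp: weight_def inner_simps algebra_simps)
qed

lemma f_apex: "f (apex j) = \<alpha> / 2 * s\<^sup>2"
  by (simp add: f_def norm_apex) (simp add: apex_def)

text \<open>Each unit of weight moved from the apex to the decoys raises the l1 term, because the
  hidden signs cohere, by more than the quadratic term can drop.\<close>

lemma f_lower:
  assumes "w \<in> body S j" "j < N"
  shows "f (apex j) + weight S w * (G\<^sup>2 / (32 * \<alpha> * real N)) \<le> f w"
proof -
  define x where "x = weight S w"
  have x: "0 \<le> x" "x \<le> 1"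
    using body_bounds[OF assms] by (auto simp: x_def)
  define q where "q = sqrt (real N)"
  have q: "0 < q" "real N = q * q"
    using N_ge by (simp_all add: q_def)
  have s: "s = G / (4 * \<alpha> * q)"
    by (simp add: s_def q_def)
  have "s / sqrt 2 * x = (\<Sum>i<N. spin S i * coord w i)"
    using s_pos by (simp add: x_def weight_eq)
  also have "\<dots> \<le> (\<Sum>i<N. \<bar>coord w i\<bar>)"
    by (intro sum_mono) (auto simp: spin_def)
  finally have l1: "s / sqrt 2 * x \<le> (\<Sum>i<N. \<bar>coord w i\<bar>)" .
  \<comment> \<open>A rational stand-in for \<open>1 / sqrt 2\<close>: 3/4 times 2/3 times the 1/4
    in \<open>s\<close> gives the 1/8 below.\<close>
  have "sqrt 2 \<le> 3 / 2"
    by (rule real_le_lsqrt) (auto simp: power2_eq_square)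
  then have "2 / 3 \<le> 1 / sqrt 2"
    by (simp add: field_simps)
  then have "s * (2 / 3) * x \<le> s * (1 / sqrt 2) * x"
    using s_pos x by (intro mult_right_mono mult_left_mono) auto
  also have "\<dots> = s / sqrt 2 * x"
    by simp
  finally have "2 / 3 * s * x \<le> (\<Sum>i<N. \<bar>coord w i\<bar>)"
    using l1 by linarith
  then have "3 * G / (4 * sqrt (real N)) * (2 / 3 * s * x) \<le> 3 * G / (4 * sqrt (real N)) * (\<Sum>i<N. \<bar>coord w i\<bar>)"
    using G_pos by (intro mult_left_mono) auto
  moreover have "3 * G / (4 * sqrt (real N)) * (2 / 3 * s * x) = x * (G\<^sup>2 / (8 * \<alpha> * real N))"
    unfolding q_def[symmetric] s q(2) using alpha_pos q(1) by (simp add: power2_eq_square field_simps)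
  ultimately have A: "x * (G\<^sup>2 / (8 * \<alpha> * real N)) \<le> 3 * G / (4 * sqrt (real N)) * (\<Sum>i<N. \<bar>coord w i\<bar>)"
    by simp
  have "s * (1 - x) \<le> coord w (N + j)"
    using body_bounds(3)[OF assms] by (simp add: x_def)
  also have "\<dots> \<le> norm w"
    using norm_cauchy_schwarz[of "unit_point (N + j)" w] by (simp add: norm_eq_sqrt_inner[of "unit_point (N + j)"])
  finally have "(s * (1 - x))\<^sup>2 \<le> (norm w)\<^sup>2"
    using s_pos x by (intro power_mono) auto
  \<comment> \<open>Discarding the square of \<open>s * x\<close> makes the loss linear in the
    weight: at most alpha s^2 per unit.\<close>
  moreover have "s\<^sup>2 * (1 - 2 * x) \<le> (s * (1 - x))\<^sup>2"
    using zero_le_power2[of "s * x"] by (simp add: power2_eq_square algebra_simps)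
  ultimately have "\<alpha> / 2 * (s\<^sup>2 * (1 - 2 * x)) \<le> \<alpha> / 2 * (norm w)\<^sup>2"
    using alpha_pos by (intro mult_left_mono) auto
  moreover have "\<alpha> * s\<^sup>2 = G\<^sup>2 / (16 * \<alpha> * real N)"
    unfolding s q(2) using alpha_pos q(1) by (simp add: power2_eq_square field_simps)
  then have "x * (\<alpha> * s\<^sup>2) = x * (G\<^sup>2 / (16 * \<alpha> * real N))"
    by simp
  ultimately have B: "\<alpha> / 2 * s\<^sup>2 - x * (G\<^sup>2 / (16 * \<alpha> * real N)) \<le> \<alpha> / 2 * (norm w)\<^sup>2"
    by (simp add: algebra_simps)
  \<comment> \<open>The surplus 1/8 - 1/16 = 1/16 is rounded down to the claimed 1/32.\<close>
  have "x * (G\<^sup>2 / (32 * \<alpha> * real N)) \<le> x * (G\<^sup>2 / (16 * \<alpha> * real N))"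
    using x alpha_pos N_ge by (intro mult_left_mono divide_left_mono) auto
  moreover have "x * (G\<^sup>2 / (8 * \<alpha> * real N)) = 2 * (x * (G\<^sup>2 / (16 * \<alpha> * real N)))"
    by simp
  ultimately show ?thesis
    using A B unfolding f_apex f_def[of w] x_def[symmetric] by linarith
qed

lemma finite_decoys: "finite (decoys S)"
proof -
  have "decoys S \<subseteq> (\<lambda>(i, k, l). decoy S i k l) ` ({..<N} \<times> {..<N} \<times> {..<N})"
    unfolding decoys_def by force
  then show ?thesis
    by (rule finite_subset) auto
qed

text \<open>All generators lie on the sphere of radius \<open>s\<close>, which encloses the body, so
  none is lost when passing to extreme points; conversely, a hull has no extreme points outside its
  generators.\<close>

lemma vertices_inst:
  assumes "j < N"
  shows "vertices (inst S j) = insert (apex j) (decoys S)"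
proof -
  have "v extreme_point_of body S j" if "v \<in> insert (apex j) (decoys S)" for v
  proof (rule extreme_point_of_sphere)
    show "v \<in> body S j"
      unfolding body_def using that by (rule hull_inc)
    show "norm v = s"
      using that norm_apex norm_decoy by auto
  qed (use body_bounds(5) assms in auto)
  moreover have "v \<in> insert (apex j) (decoys S)" if "v extreme_point_of body S j" for v
    using that extreme_point_of_convex_hull unfolding body_def by blast
  ultimately show ?thesis
    unfolding vertices_def inst_def by auto
qed

section \<open>Convexity and subgradients of the objective\<close>

lemma f_strongly_convex: "strongly_convex_on (Rn n) \<alpha> f"
  unfolding strongly_convex_on_def
proof (intro conjI ballI)
  show "convex (Rn n)"
    by (intro subspace_imp_convex subspace_Rn)
  fix x y :: point and t :: real
  assume t: "t \<in> {0..1}"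
  define c where "c = 3 * G / (4 * sqrt (real N))"
  have c: "0 \<le> c"
    using G_pos by (simp add: c_def)
  have "(\<Sum>i<N. \<bar>coord ((1 - t) *\<^sub>R x + t *\<^sub>R y) i\<bar>)
      \<le> (\<Sum>i<N. (1 - t) * \<bar>coord x i\<bar> + t * \<bar>coord y i\<bar>)"
  proof (intro sum_mono)
    fix i
    have "\<bar>(1 - t) * coord x i + t * coord y i\<bar> \<le> \<bar>(1 - t) * coord x i\<bar> + \<bar>t * coord y i\<bar>"
      by (rule abs_triangle_ineq)
    then show "\<bar>coord ((1 - t) *\<^sub>R x + t *\<^sub>R y) i\<bar> \<le> (1 - t) * \<bar>coord x i\<bar> + t * \<bar>coord y i\<bar>"
      using t by (simp add: abs_mult)
  qed
  also have "\<dots> = (1 - t) * (\<Sum>i<N. \<bar>coord x i\<bar>) + t * (\<Sum>i<N. \<bar>coord y i\<bar>)"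
    by (simp add: sum.distrib sum_distrib_left)
  finally have "c * (\<Sum>i<N. \<bar>coord ((1 - t) *\<^sub>R x + t *\<^sub>R y) i\<bar>)
      \<le> c * ((1 - t) * (\<Sum>i<N. \<bar>coord x i\<bar>) + t * (\<Sum>i<N. \<bar>coord y i\<bar>))"
    using c by (rule mult_left_mono)
  also have "\<dots> = (1 - t) * (c * (\<Sum>i<N. \<bar>coord x i\<bar>)) + t * (c * (\<Sum>i<N. \<bar>coord y i\<bar>))"
    by (simp add: distrib_left mult.left_commute)
  moreover have "\<alpha> / 2 * ((1 - t) * (norm x)\<^sup>2 + t * (norm y)\<^sup>2 - t * (1 - t) * (norm (x - y))\<^sup>2)
      = (1 - t) * (\<alpha> / 2 * (norm x)\<^sup>2) + t * (\<alpha> / 2 * (norm y)\<^sup>2) - \<alpha> / 2 * t * (1 - t) * (norm (x - y))\<^sup>2"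
    by (simp add: field_simps)
  ultimately show "f ((1 - t) *\<^sub>R x + t *\<^sub>R y)
      \<le> (1 - t) * f x + t * f y - \<alpha> / 2 * t * (1 - t) * (norm (x - y))\<^sup>2"
    unfolding f_def c_def[symmetric] norm_convex_combination distrib_left[of "1 - t"] distrib_left[of t] by linarith
qed

text \<open>Coordinatewise, \<open>sgn\<close> is a subgradient of the absolute value (at 0 it
  selects 0), and linearising the quadratic term leaves the nonnegative remainder alpha/2 |z -
  w|^2.\<close>

lemma subgrad_in:
  assumes "w \<in> Rn (2 * N)"
  shows "subgrad w \<in> subdifferential (2 * N) f w"
proof -
  define c where "c = 3 * G / (4 * sqrt (real N))"
  have c: "0 \<le> c"
    using G_pos by (simp add: c_def)
  have "subgrad w \<in> Rn (2 * N)"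
    unfolding subgrad_def using assms
    by (intro subspace_add subspace_mul subspace_sum subspace_Rn unit_point_in_Rn) auto
  moreover have "f w + inner (subgrad w) (z - w) \<le> f z" for z
  proof -
    have "(\<Sum>i<N. sgn (coord w i) * coord (z - w) i) \<le> (\<Sum>i<N. \<bar>coord z i\<bar> - \<bar>coord w i\<bar>)"
      by (intro sum_mono) (auto simp: sgn_if)
    then have "c * (\<Sum>i<N. sgn (coord w i) * coord (z - w) i) \<le> c * (\<Sum>i<N. \<bar>coord z i\<bar> - \<bar>coord w i\<bar>)"
      using c by (rule mult_left_mono)
    then have 1: "c * (\<Sum>i<N. sgn (coord w i) * coord (z - w) i)
        \<le> c * (\<Sum>i<N. \<bar>coord z i\<bar>) - c * (\<Sum>i<N. \<bar>coord w i\<bar>)"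
      by (simp add: sum_subtractf right_diff_distrib)
    have "0 \<le> \<alpha> / 2 * (norm (z - w))\<^sup>2"
      using alpha_pos by simp
    also have "\<dots> = \<alpha> / 2 * (norm z)\<^sup>2 - \<alpha> / 2 * (norm w)\<^sup>2 - \<alpha> * inner w (z - w)"
      unfolding power2_norm_eq_inner by (simp add: inner_simps inner_commute algebra_simps)
    finally show ?thesis
      using 1 unfolding subgrad_def f_def c_def[symmetric]
      by (simp add: inner_add_left inner_unit_sum del: coord_simps)
  qed
  ultimately show ?thesis
    by (simp add: subdifferential_def)
qed

text \<open>Comparing \<open>f\<close> at \<open>w\<close> and at \<open>w + g / (8 \<alpha>)\<close> suffices, because the Lipschitz constant
  of \<open>f\<close> near \<open>w\<close> stays below \<open>7/8 G\<close>.\<close>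

lemma subgradient_bound:
  assumes "norm w \<le> s" "w \<in> Rn n" "g \<in> subdifferential n f w"
  shows "norm g \<le> G"
proof -
  define c where "c = 3 * G / (4 * sqrt (real N))"
  define \<epsilon> where "\<epsilon> = 1 / (8 * \<alpha>)"
  have c: "0 \<le> c" and e: "0 < \<epsilon>"
    using G_pos alpha_pos by (simp_all add: c_def \<epsilon>_def)
  have cN: "c * sqrt (real N) = 3 / 4 * G"
    using N_ge by (simp add: c_def)
  have "w + \<epsilon> *\<^sub>R g \<in> Rn n"
    using assms by (intro subspace_add subspace_mul subspace_Rn) (auto simp: subdifferential_def)
  then have *: "f w + inner g ((w + \<epsilon> *\<^sub>R g) - w) \<le> f (w + \<epsilon> *\<^sub>R g)"
    using assms by (auto simp: subdifferential_def)
  have "(\<Sum>i<N. \<bar>coord (w + \<epsilon> *\<^sub>R g) i\<bar>) \<le> (\<Sum>i<N. \<bar>coord w i\<bar> + \<epsilon> * \<bar>coord g i\<bar>)"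
  proof (intro sum_mono)
    fix i
    have "\<bar>coord w i + \<epsilon> * coord g i\<bar> \<le> \<bar>coord w i\<bar> + \<bar>\<epsilon> * coord g i\<bar>"
      by (rule abs_triangle_ineq)
    then show "\<bar>coord (w + \<epsilon> *\<^sub>R g) i\<bar> \<le> \<bar>coord w i\<bar> + \<epsilon> * \<bar>coord g i\<bar>"
      using e by (simp add: abs_mult)
  qed
  also have "\<dots> = (\<Sum>i<N. \<bar>coord w i\<bar>) + \<epsilon> * (\<Sum>i<N. \<bar>coord g i\<bar>)"
    by (simp add: sum.distrib sum_distrib_left)
  also have "\<dots> \<le> (\<Sum>i<N. \<bar>coord w i\<bar>) + \<epsilon> * (sqrt (real N) * norm g)"
    using e by (intro add_left_mono mult_left_mono sum_abs_coord_le) auto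
  finally have "c * (\<Sum>i<N. \<bar>coord (w + \<epsilon> *\<^sub>R g) i\<bar>)
      \<le> c * ((\<Sum>i<N. \<bar>coord w i\<bar>) + \<epsilon> * (sqrt (real N) * norm g))"
    using c by (rule mult_left_mono)
  also have "\<dots> = c * (\<Sum>i<N. \<bar>coord w i\<bar>) + \<epsilon> * (3 / 4 * G * norm g)"
    unfolding cN[symmetric] by (simp add: algebra_simps)
  finally have 1: "c * (\<Sum>i<N. \<bar>coord (w + \<epsilon> *\<^sub>R g) i\<bar>)
      \<le> c * (\<Sum>i<N. \<bar>coord w i\<bar>) + \<epsilon> * (3 / 4 * G * norm g)" .
  have "\<alpha> / 2 * (norm (w + \<epsilon> *\<^sub>R g))\<^sup>2
      = \<alpha> / 2 * (norm w)\<^sup>2 + \<epsilon> * (\<alpha> * inner w g) + \<epsilon> * (\<alpha> * \<epsilon> / 2 * (norm g)\<^sup>2)"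
    unfolding power2_norm_eq_inner by (simp add: inner_simps inner_commute algebra_simps)
  also have "\<alpha> * \<epsilon> / 2 = 1 / 16"
    using alpha_pos by (simp add: \<epsilon>_def)
  finally have "\<epsilon> * (norm g)\<^sup>2 \<le> \<epsilon> * (3 / 4 * G * norm g + \<alpha> * inner w g + 1 / 16 * (norm g)\<^sup>2)"
    using * 1 unfolding f_def c_def[symmetric]
    by (simp add: power2_norm_eq_inner algebra_simps)
  then have "(norm g)\<^sup>2 \<le> 3 / 4 * G * norm g + \<alpha> * inner w g + 1 / 16 * (norm g)\<^sup>2"
    using e by simp
  moreover have "\<alpha> * inner w g \<le> \<alpha> * (s * norm g)"
    using alpha_pos assms(1) norm_cauchy_schwarz[of w g] mult_right_mono[of "norm w" s "norm g"]
    by (intro mult_left_mono) auto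
  moreover have "\<alpha> * s * norm g \<le> G / 8 * norm g"
    by (intro mult_right_mono s_le) simp
  \<comment> \<open>The 7/8 is 3/4 from the l1 term plus 1/8 from \<open>s_le\<close>; the 15/16 is
    1 minus the second-order term. As 7/8 < 15/16, the bound \<open>G\<close> follows.\<close>
  ultimately have "(norm g)\<^sup>2 * (15 / 16) \<le> 7 / 8 * G * norm g"
    by simp
  then have "norm g * (norm g * (15 / 16)) \<le> norm g * (7 / 8 * G)"
    by (simp add: power2_eq_square mult.assoc mult.commute mult.left_commute)
  then have "norm g = 0 \<or> norm g * (15 / 16) \<le> 7 / 8 * G"
    by (smt (verit) mult_le_cancel_left norm_ge_zero)
  then show ?thesis
    using G_pos by auto
qed

lemma problem_instance_inst:
  assumes "j < N"
  shows "problem_instance \<alpha> G (2 * N) (inst S j) (apex j)"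
proof -
  have gap: "0 < G\<^sup>2 / (32 * \<alpha> * real N)"
    using G_pos alpha_pos N_ge by simp
  have sim: "feasible (inst S j) = body S j" "objective (inst S j) = f" "subgradient_rule (inst S j) = subgrad"
    by (simp_all add: inst_def)
  have apex: "apex j \<in> body S j"
    unfolding body_def by (rule hull_inc) simp
  have min: "f (apex j) \<le> f w" if "w \<in> body S j" for w
    using f_lower[OF that assms] body_bounds(1)[OF that assms] gap
    by (smt (verit) mult_nonneg_nonneg)
  have uniq: "w = apex j" if w: "w \<in> body S j" "f w \<le> f (apex j)" for w
  proof -
    have "weight S w * (G\<^sup>2 / (32 * \<alpha> * real N)) \<le> 0"
      using f_lower[OF w(1) assms] w(2) by linarith
    then have "weight S w = 0"
      using gap body_bounds(1)[OF w(1) assms] by (smt (verit) mult_pos_pos)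
    then have 1: "s \<le> coord w (N + j)"
      using body_bounds(3)[OF w(1) assms] by simp
    \<comment> \<open>A point of norm at most \<open>s\<close> whose coordinate \<open>N + j\<close>
      is at least \<open>s\<close> is the apex: the equality case of Cauchy-Schwarz.\<close>
    have "(norm (w - apex j))\<^sup>2 = (norm w)\<^sup>2 + (norm (apex j))\<^sup>2 - 2 * inner (apex j) w"
      unfolding power2_norm_eq_inner by (simp add: inner_simps inner_commute)
    also have "\<dots> \<le> s\<^sup>2 + s\<^sup>2 - 2 * (s * s)"
      using body_bounds(5)[OF w(1) assms] s_pos 1
      unfolding norm_apex inner_apex
      by (intro diff_mono add_mono power_mono mult_left_mono) auto
    finally have "(norm (w - apex j))\<^sup>2 \<le> 0"
      by (simp add: power2_eq_square)
    then show ?thesis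
      by simp
  qed
  have "is_arg_min f (\<lambda>z. z \<in> body S j) z \<longleftrightarrow> z = apex j" for z
    unfolding is_arg_min_linorder using apex min uniq by auto
  then have "unique_minimizer (inst S j) (apex j)"
    by (simp add: unique_minimizer_def sim)
  moreover have "sparse_projection_rule (2 * N) (inst S j)"
    unfolding sparse_projection_rule_def
  proof
    fix y
    let ?p = "projection_rule (inst S j) y" and ?V = "insert (apex j) (decoys S)"
    have n: "norm v = s" if "v \<in> ?V" for v
      using that norm_apex norm_decoy by auto
    have p: "?p \<in> ?V"
      using best_decoy_in by (simp add: inst_def)
    have "inner v y \<le> inner ?p y" if "v \<in> ?V" for v
      using that best_decoy_max[of v S y] by (auto simp: inst_def hits_def)
    then have "norm (?p - y) \<le> norm (v - y)" if "v \<in> ?V" for v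
      using that p n by (subst norm_le_iff_inner) auto
    then show "is_arg_min (\<lambda>z. norm (z - y)) (\<lambda>z. z \<in> vertices (inst S j)) ?p"
      unfolding is_arg_min_linorder vertices_inst[OF assms] using p by blast
  qed
  moreover have "convex (body S j)" "compact (body S j)"
    unfolding body_def by (auto intro: finite_imp_compact_convex_hull finite_decoys)
  ultimately show ?thesis
    unfolding problem_instance_def sim vertices_inst[OF assms]
    using body_bounds(5,6)[OF _ assms] subgradient_bound f_strongly_convex subgrad_in by blast
qed

end

section \<open>Runs of a deterministic method\<close>

lemma transcript_0 [simp]: "transcript m I 0 = []"
  by (simp add: transcript_def)

lemma transcript_Suc: "transcript m I (Suc t) = step m I (transcript m I t)"
  by (simp add: transcript_def)

lemma projection_calls_0 [simp]: "projection_calls m I 0 = 0"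
  by (simp add: projection_calls_def)

lemma projection_calls_Suc: "projection_calls m I (Suc t) =
    projection_calls m I t + (case m (transcript m I t) of Project y \<Rightarrow> 1 | _ \<Rightarrow> 0)"
  by (simp add: projection_calls_def transcript_Suc step_def split: action.split)

lemma projection_calls_mono: "t \<le> t' \<Longrightarrow> projection_calls m I t \<le> projection_calls m I t'"
  by (rule lift_Suc_mono_le[of "projection_calls m I"]) (simp_all add: projection_calls_Suc)

text \<open>With at least two letters, the doubling in the induction step is absorbed by one more
  factor \<open>card A\<close>, so the geometric sum costs no extra constant.\<close>

lemma card_lists_length_less:
  assumes "finite A" "2 \<le> card A"
  shows "finite {xs. set xs \<subseteq> A \<and> length xs < n}"
    and "card {xs. set xs \<subseteq> A \<and> length xs < n} \<le> card A ^ n"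
proof (induction n)
  case (Suc n)
  let ?L = "\<lambda>n. {xs. set xs \<subseteq> A \<and> length xs < n}" and ?E = "{xs. set xs \<subseteq> A \<and> length xs = n}"
  {
    case 1
    have "?L (Suc n) = ?L n \<union> ?E"
      by auto
    then show ?case
      using Suc finite_lists_length_eq[OF assms(1)] by simp
  next
    case 2
    have "?L (Suc n) = ?L n \<union> ?E"
      by auto
    then have "card (?L (Suc n)) \<le> card (?L n) + card ?E"
      by (simp add: card_Un_le)
    also have "\<dots> \<le> card A ^ n + card A ^ n"
      using Suc(2) card_lists_length_eq[OF assms(1)] by simp
    also have "\<dots> \<le> card A ^ Suc n"
      using mult_le_mono1[OF assms(2), of "card A ^ n"] by (simp only: power_Suc mult_2)
    finally show ?case .
  }
qed simp_all

context hard_family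
begin

lemma shadow_simps [simp]:
  "projection_rule (shadow S) = best_decoy S" "objective (shadow S) = f" "subgradient_rule (shadow S) = subgrad"
  by (simp_all add: shadow_def)

lemma inst_simps [simp]:
  "projection_rule (inst S j) y = (if hits S j y then apex j else best_decoy S y)"
  "objective (inst S j) = f" "subgradient_rule (inst S j) = subgrad" "feasible (inst S j) = body S j"
  by (simp_all add: inst_def)

section \<open>Queries of the shadow run and the apices they hit\<close>

definition queries :: "strategy \<Rightarrow> nat \<Rightarrow> nat set \<Rightarrow> point set"
  where "queries m T S = {y. \<exists>t. projection_calls m (shadow S) t < T \<and> m (transcript m (shadow S) t) = Project y}"

definition hit_set :: "strategy \<Rightarrow> nat \<Rightarrow> nat set \<Rightarrow> nat set"
  where "hit_set m T S = {j. j < N \<and> (\<exists>y\<in>queries m T S. hits S j y)}"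

text \<open>The signs of some query are exactly opposite to the pattern. Without such a query each
  query has an axis as required by \<open>hits_unique\<close>; with one, the pattern can be read
  off.\<close>

definition guessed :: "strategy \<Rightarrow> nat \<Rightarrow> nat set \<Rightarrow> bool"
  where "guessed m T S \<longleftrightarrow> (\<exists>y\<in>queries m T S. \<forall>i<N. spin S i * coord y i < 0)"

text \<open>The call counter increases right after a projection query, so each counter value below
  \<open>T\<close> belongs to at most one query.\<close>

lemma card_queries: "finite (queries m T S)" "card (queries m T S) \<le> T"
proof -
  let ?at = "\<lambda>c y. \<exists>t. projection_calls m (shadow S) t = c \<and> m (transcript m (shadow S) t) = Project y"
  have later: "projection_calls m (shadow S) t < projection_calls m (shadow S) t'"
    if "t < t'" "m (transcript m (shadow S) t) = Project y" for t t' y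
    using projection_calls_mono[of "Suc t" t' m "shadow S"] that by (simp add: projection_calls_Suc)
  have uniq: "y = y'" if "?at c y" "?at c y'" for c y y'
    using that later by (metis action.inject(1) less_irrefl linorder_neqE_nat)
  have sub: "queries m T S \<subseteq> (\<lambda>c. SOME y. ?at c y) ` {..<T}"
  proof
    fix y assume "y \<in> queries m T S"
    then obtain c where c: "c < T" "?at c y"
      by (auto simp: queries_def)
    then have "?at c (SOME y. ?at c y)"
      by (intro someI_ex[of "?at c"]) blast
    then have "y = (SOME y. ?at c y)"
      using uniq c by blast
    then show "y \<in> (\<lambda>c. SOME y. ?at c y) ` {..<T}"
      using c(1) by blast
  qed
  then show "finite (queries m T S)"
    by (rule finite_subset) simp
  have "card (queries m T S) \<le> card ((\<lambda>c. SOME y. ?at c y) ` {..<T})"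
    using sub by (intro card_mono) auto
  also have "\<dots> \<le> T"
    using card_image_le[of "{..<T}" "\<lambda>c. SOME y. ?at c y"] by simp
  finally show "card (queries m T S) \<le> T" .
qed

lemma card_hit_set:
  assumes "\<not> guessed m T S"
  shows "card (hit_set m T S) \<le> T"
proof -
  have one: "card {j. j < N \<and> hits S j y} \<le> 1" if y: "y \<in> queries m T S" for y
  proof -
    obtain i where "i < N" "0 \<le> spin S i * coord y i"
      using assms y unfolding guessed_def by (meson not_less)
    then show ?thesis
      using hits_unique by (intro card_le_Suc0_iff_eq[THEN iffD2, simplified One_nat_def[symmetric]]) auto
  qed
  have "hit_set m T S = (\<Union>y\<in>queries m T S. {j. j < N \<and> hits S j y})"
    by (auto simp: hit_set_def)
  then have "card (hit_set m T S) \<le> (\<Sum>y\<in>queries m T S. card {j. j < N \<and> hits S j y})"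
    using card_UN_le[OF card_queries(1)] by simp
  also have "\<dots> \<le> (\<Sum>y\<in>queries m T S. 1)"
    by (intro sum_mono one)
  finally show ?thesis
    using card_queries(2)[of m T S] by simp
qed

text \<open>While the two transcripts agree, so do the call counts; the next projection query is
  thus among the first \<open>T\<close> shadow queries, misses the apex, and gets the same decoy in
  both runs.\<close>

lemma transcript_eq_shadow:
  assumes "\<And>t. projection_calls m (inst S j) t \<le> T" "j < N" "j \<notin> hit_set m T S"
  shows "transcript m (inst S j) t = transcript m (shadow S) t"
proof (induction t)
  case (Suc t)
  show ?case
  proof (cases "m (transcript m (shadow S) t)")
    case (Project y)
    have "projection_calls m (inst S j) (Suc t) = projection_calls m (inst S j) t + 1"
      using Project by (simp add: projection_calls_Suc Suc)
    moreover have "projection_calls m (inst S j) t = projection_calls m (shadow S) t"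
      by (simp add: projection_calls_def Suc)
    ultimately have "projection_calls m (shadow S) t < T"
      using assms(1)[of "Suc t"] by simp
    then have "\<not> hits S j y"
      using assms(2,3) Project by (auto simp: hit_set_def queries_def)
    then show ?thesis
      using Suc Project by (simp add: transcript_Suc step_def)
  qed (simp_all add: transcript_Suc step_def Suc)
qed simp

section \<open>Coding the guessed patterns by trails of answers\<close>

text \<open>Given the query, this pair determines the decoy that is returned.\<close>

definition code :: "nat set \<Rightarrow> point \<Rightarrow> nat \<times> bool"
  where "code S y = (best_axis S y, best_axis S y \<in> S)"

text \<open>A compressed transcript of the shadow run. First-order steps leave no entry because
  their answers are the same for every pattern.\<close>

primrec trail :: "strategy \<Rightarrow> nat set \<Rightarrow> nat \<Rightarrow> (nat \<times> bool) list"
  where "trail m S 0 = []"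
  | "trail m S (Suc t) = trail m S t @
      (case m (transcript m (shadow S) t) of Project y \<Rightarrow> [code S y] | _ \<Rightarrow> [])"

lemma length_trail: "length (trail m S t) = projection_calls m (shadow S) t"
  by (induction t) (simp_all add: projection_calls_Suc split: action.split)

lemma trail_prefix: "\<exists>xs. trail m S (t + k) = trail m S t @ xs"
  by (induction k) auto

lemma set_trail: "set (trail m S t) \<subseteq> {..<N} \<times> UNIV"
  by (induction t) (auto simp: code_def best_axis(1) split: action.splits)

lemma best_decoy_code: "code S y = code S' y \<Longrightarrow> best_decoy S y = best_decoy S' y"
  by (auto simp: code_def best_decoy_def decoy_def spin_def)

text \<open>First-order answers do not depend on the pattern, and by \<open>best_decoy_code\<close>
  each trail entry recovers a projection answer once the query is known, which the earlier answers
  determine.\<close>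

lemma trail_determines_transcript:
  assumes "trail m S t = trail m S' t'" "t \<le> t'" "r \<le> t"
  shows "transcript m (shadow S) r = transcript m (shadow S') r"
  using assms(3)
proof (induction r)
  case (Suc r)
  then have IH: "transcript m (shadow S) r = transcript m (shadow S') r"
    by simp
  show ?case
  proof (cases "m (transcript m (shadow S) r)")
    case (Project y)
    obtain xs where "trail m S t = trail m S (Suc r) @ xs"
      using trail_prefix[of m S "Suc r" "t - Suc r"] Suc(2) by auto
    moreover obtain ys where "trail m S' t' = trail m S' (Suc r) @ ys"
      using trail_prefix[of m S' "Suc r" "t' - Suc r"] Suc(2) assms(2) by auto
    ultimately have "trail m S r @ code S y # xs = trail m S' r @ code S' y # ys"
      using assms(1) Project IH by simp
    \<comment> \<open>Equal lengths align the two lists, so the entries that follow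
      coincide.\<close>
    moreover have "length (trail m S r) = length (trail m S' r)"
      by (simp add: length_trail projection_calls_def IH)
    ultimately have "code S y = code S' y"
      by simp
    then have "best_decoy S y = best_decoy S' y"
      by (rule best_decoy_code)
    then show ?thesis
      using Project IH by (simp add: transcript_Suc step_def)
  qed (simp_all add: transcript_Suc step_def IH)
qed simp

lemma trail_determines_signs:
  assumes "trail m S t = trail m S' t'" "t \<le> t'" "S \<subseteq> {..<N}" "S' \<subseteq> {..<N}"
    and "m (transcript m (shadow S) t) = Project y" "\<forall>i<N. spin S i * coord y i < 0"
    and "m (transcript m (shadow S') t') = Project y'" "\<forall>i<N. spin S' i * coord y' i < 0"
  shows "S = S'"
proof -
  have eq: "transcript m (shadow S) t = transcript m (shadow S') t"
    using trail_determines_transcript[OF assms(1,2)] by simp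
  \<comment> \<open>Otherwise the projection made at step \<open>t\<close>, common to both runs,
    would have made the trail for \<open>S'\<close> longer than that for \<open>S\<close>.\<close>
  have "t = t'"
  proof (rule ccontr)
    assume "t \<noteq> t'"
    then have "projection_calls m (shadow S') (Suc t) \<le> projection_calls m (shadow S') t'"
      using assms(2) by (intro projection_calls_mono) simp
    also have "\<dots> = projection_calls m (shadow S) t"
      using arg_cong[OF assms(1), of length] by (simp add: length_trail)
    also have "\<dots> = projection_calls m (shadow S') t"
      by (simp add: projection_calls_def eq)
    finally show False
      using assms(5) by (simp add: projection_calls_Suc eq)
  qed
  then have "y = y'"
    using assms(5,7) eq by simp
  then have "i \<in> S \<longleftrightarrow> i \<in> S'" if "i < N" for i
    using assms(6)[rule_format, OF that] assms(8)[rule_format, OF that] \<open>y = y'\<close>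
    by (auto simp: spin_def split: if_splits)
  then show ?thesis
    using assms(3,4) by blast
qed

text \<open>A guessed pattern is encoded by the trail just before the guessing query: a list of
  fewer than \<open>T\<close> letters from an alphabet of size \<open>2 * N\<close>. By
  \<open>trail_determines_signs\<close> this encoding is injective.\<close>

lemma card_guessed: "card {S. S \<subseteq> {..<N} \<and> guessed m T S} \<le> (2 * N) ^ T"
proof -
  let ?L = "{S. S \<subseteq> {..<N} \<and> guessed m T S}" and ?A = "{..<N} \<times> (UNIV :: bool set)"
  let ?good = "\<lambda>S t. projection_calls m (shadow S) t < T \<and>
    (\<exists>y. m (transcript m (shadow S) t) = Project y \<and> (\<forall>i<N. spin S i * coord y i < 0))"
  have "\<forall>S\<in>?L. \<exists>t. ?good S t"
    unfolding guessed_def queries_def by blast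
  then obtain \<tau> where \<tau>: "?good S (\<tau> S)" if "S \<in> ?L" for S
    using bchoice[of ?L ?good] by blast
  have "inj_on (\<lambda>S. trail m S (\<tau> S)) ?L"
  proof (rule inj_onI)
    fix S S' assume S: "S \<in> ?L" "S' \<in> ?L" and eq: "trail m S (\<tau> S) = trail m S' (\<tau> S')"
    show "S = S'"
      using \<tau>[OF S(1)] \<tau>[OF S(2)] S
        trail_determines_signs[OF eq] trail_determines_signs[OF eq[symmetric]]
      by (cases "\<tau> S \<le> \<tau> S'") auto
  qed
  moreover have "(\<lambda>S. trail m S (\<tau> S)) ` ?L \<subseteq> {xs. set xs \<subseteq> ?A \<and> length xs < T}"
    using set_trail \<tau> by (auto simp: length_trail)
  moreover have A: "finite ?A" "card ?A = 2 * N"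
    by (simp_all add: card_cartesian_product)
  ultimately have "card ?L \<le> card {xs. set xs \<subseteq> ?A \<and> length xs < T}"
    using N_ge by (intro card_inj_on_le card_lists_length_less) auto
  also have "\<dots> \<le> card ?A ^ T"
    using A N_ge by (intro card_lists_length_less) auto
  finally show ?thesis
    by (simp add: A(2))
qed

section \<open>Errors across the family of instances\<close>

definition error :: "strategy \<Rightarrow> nat set \<Rightarrow> nat \<Rightarrow> ennreal"
  where "error m S j = e2ennreal (extended_objective (inst S j) (the_output m (inst S j))
    - extended_objective (inst S j) (apex j))"

text \<open>An infeasible output has infinite error; a feasible one pays half of the gap in
  \<open>f_lower\<close>.\<close>

lemma error_lower:
  assumes "j < N" "the_output m (inst S j) \<in> body S j \<Longrightarrow> 1 / 2 \<le> weight S (the_output m (inst S j))"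
  shows "ennreal (G\<^sup>2 / (64 * \<alpha> * real N)) \<le> error m S j"
proof -
  let ?w = "the_output m (inst S j)"
  have apex: "extended_objective (inst S j) (apex j) = ereal (f (apex j))"
    by (simp add: extended_objective_def) (simp add: body_def hull_inc)
  show ?thesis
  proof (cases "?w \<in> body S j")
    case True
    have "0 \<le> G\<^sup>2 / (32 * \<alpha> * real N)"
      using alpha_pos by simp
    with assms(2)[OF True] have "1 / 2 * (G\<^sup>2 / (32 * \<alpha> * real N)) \<le> weight S ?w * (G\<^sup>2 / (32 * \<alpha> * real N))"
      by (rule mult_right_mono)
    then have "G\<^sup>2 / (64 * \<alpha> * real N) \<le> f ?w - f (apex j)"
      using f_lower[OF True assms(1)] by simp
    then show ?thesis
      unfolding error_def apex by (simp add: extended_objective_def True e2ennreal_ereal ennreal_leI)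
  next
    case False
    then show ?thesis
      unfolding error_def apex by (simp add: extended_objective_def e2ennreal_infty)
  qed
qed

text \<open>Light decoy weight pushes coordinate \<open>N + j\<close> above \<open>s / 2\<close>,
  whereas a body with another apex keeps it below \<open>s / 4\<close>. The functional
  \<open>weight S\<close> is the same for both bodies.\<close>

lemma apex_identified:
  assumes "w \<in> body S j" "weight S w < 1 / 2" "w \<in> body S k" "j < N" "k < N"
  shows "j = k"
proof (rule ccontr)
  assume "j \<noteq> k"
  then have "s * (1 - weight S w) \<le> s / 2 * weight S w"
    using body_bounds(3)[OF assms(1,4)] body_bounds(4)[OF assms(3,5,4)] by linarith
  then have "s * (1 - weight S w) \<le> s * (weight S w / 2)"
    by simp
  then show False
    using s_pos assms(2) by simp
qed

text \<open>Outside \<open>hit_set\<close> the output is that of the shadow run and does not depend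
  on \<open>j\<close>. This single point is good for at most one index, which explains the
  \<open>+ 1\<close>.\<close>

lemma card_small_error:
  assumes "\<And>j t. j < N \<Longrightarrow> projection_calls m (inst S j) t \<le> T" "\<not> guessed m T S"
  shows "card {j. j < N \<and> error m S j < ennreal (G\<^sup>2 / (64 * \<alpha> * real N))} \<le> T + 1"
proof -
  define w where "w = the_output m (shadow S)"
  let ?J = "{j. j < N \<and> w \<in> body S j \<and> weight S w < 1 / 2}"
  have out: "the_output m (inst S j) = w" if "j < N" "j \<notin> hit_set m T S" for j
    unfolding w_def the_output_def outputs_def
    using transcript_eq_shadow[OF assms(1)] that by simp
  have "{j. j < N \<and> error m S j < ennreal (G\<^sup>2 / (64 * \<alpha> * real N))} \<subseteq> hit_set m T S \<union> ?J"
  proof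
    fix j assume j: "j \<in> {j. j < N \<and> error m S j < ennreal (G\<^sup>2 / (64 * \<alpha> * real N))}"
    show "j \<in> hit_set m T S \<union> ?J"
    proof (cases "j \<in> hit_set m T S")
      case False
      then show ?thesis
        using error_lower[of j m S] out[of j] j by (force simp: not_le[symmetric])
    qed simp
  qed
  then have "card {j. j < N \<and> error m S j < ennreal (G\<^sup>2 / (64 * \<alpha> * real N))} \<le> card (hit_set m T S \<union> ?J)"
    by (intro card_mono) (auto simp: hit_set_def)
  also have "\<dots> \<le> card (hit_set m T S) + card ?J"
    by (rule card_Un_le)
  also have "card ?J \<le> 1"
    using apex_identified by (intro card_le_Suc0_iff_eq[THEN iffD2, simplified One_nat_def[symmetric]]) auto
  finally show ?thesis
    using card_hit_set[OF assms(2)] by linarith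
qed

text \<open>At least 3/4 of the patterns are never guessed, and for each of them at least 2/3 of the
  indices have error G^2/(64 alpha N) or more. The product 3/4 * 2/3 = 1/2 yields 128.\<close>

lemma sum_error_lower:
  assumes calls: "\<And>S j t. S \<subseteq> {..<N} \<Longrightarrow> j < N \<Longrightarrow> projection_calls m (inst S j) t \<le> T"
    and T: "3 * (T + 1) \<le> N" "4 * (2 * N) ^ T \<le> 2 ^ N"
  shows "ennreal (2 ^ N * real N * (G\<^sup>2 / (128 * \<alpha> * real N))) \<le> (\<Sum>(S, j)\<in>Pow {..<N} \<times> {..<N}. error m S j)"
proof -
  define g where "g = G\<^sup>2 / (64 * \<alpha> * real N)"
  have g: "0 \<le> g"
    using alpha_pos by (simp add: g_def)
  define P where "P = {S. S \<subseteq> {..<N} \<and> \<not> guessed m T S}"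
  have "Pow {..<N} = P \<union> {S. S \<subseteq> {..<N} \<and> guessed m T S}"
    by (auto simp: P_def)
  then have "card (Pow {..<N}) \<le> card P + card {S. S \<subseteq> {..<N} \<and> guessed m T S}"
    by (metis card_Un_le)
  then have "2 ^ N \<le> card P + (2 * N) ^ T"
    using card_guessed[of m T] by (simp add: card_Pow)
  then have P: "3 * 2 ^ N \<le> 4 * card P"
    using T(2) by linarith
  have row: "ennreal (2 / 3 * real N * g) \<le> (\<Sum>j<N. error m S j)" if S: "S \<in> P" for S
  proof -
    let ?B = "{j. j < N \<and> error m S j < ennreal g}"
    have B: "card ?B \<le> T + 1"
      using card_small_error[of m S T] calls S by (auto simp: P_def g_def)
    have "card ({..<N} - ?B) = N - card ?B"
      by (subst card_Diff_subset) auto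
    then have "2 * N \<le> 3 * card ({..<N} - ?B)"
      using B T(1) by arith
    then have "2 / 3 * real N \<le> real (card ({..<N} - ?B))"
      by linarith
    then have "ennreal (2 / 3 * real N * g) \<le> ennreal (real (card ({..<N} - ?B)) * g)"
      using g by (intro ennreal_leI mult_right_mono)
    also have "\<dots> = (\<Sum>j\<in>{..<N} - ?B. ennreal g)"
      using g by (subst sum_ennreal) auto
    also have "\<dots> \<le> (\<Sum>j\<in>{..<N} - ?B. error m S j)"
      by (intro sum_mono) (auto simp: not_less)
    also have "\<dots> \<le> (\<Sum>j<N. error m S j)"
      by (intro sum_mono2) auto
    finally show ?thesis .
  qed
  have "3 / 4 * 2 ^ N \<le> real (card P)"
    using P[unfolded of_nat_le_iff[symmetric, where 'a = real]] by simp
  then have "3 / 4 * 2 ^ N * (2 / 3 * real N * g) \<le> real (card P) * (2 / 3 * real N * g)"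
    using g by (intro mult_right_mono) auto
  moreover have "2 ^ N * real N * (G\<^sup>2 / (128 * \<alpha> * real N)) = 3 / 4 * 2 ^ N * (2 / 3 * real N * g)"
    by (simp add: g_def)
  ultimately have "ennreal (2 ^ N * real N * (G\<^sup>2 / (128 * \<alpha> * real N))) \<le> ennreal (real (card P) * (2 / 3 * real N * g))"
    by (intro ennreal_leI) linarith
  also have "\<dots> = (\<Sum>S\<in>P. ennreal (2 / 3 * real N * g))"
    using g by (subst sum_ennreal) auto
  also have "\<dots> \<le> (\<Sum>S\<in>P. \<Sum>j<N. error m S j)"
    by (intro sum_mono row)
  also have "\<dots> \<le> (\<Sum>S\<in>Pow {..<N}. \<Sum>j<N. error m S j)"
    by (intro sum_mono2) (auto simp: P_def)
  also have "\<dots> = (\<Sum>(S, j)\<in>Pow {..<N} \<times> {..<N}. error m S j)"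
    by (rule sum.cartesian_product)
  finally show ?thesis .
qed

section \<open>Averaging over the randomness\<close>

lemma f_measurable: "f \<in> borel_measurable borel"
  by (intro borel_measurable_continuous_onI)
    (use N_ge in \<open>auto simp: f_def inner_unit_point[symmetric] simp del: inner_unit_point intro!: continuous_intros\<close>)

lemma extended_objective_measurable: "extended_objective (inst S j) \<in> borel_measurable borel"
proof -
  have "body S j \<in> sets borel"
    unfolding body_def
    by (intro borel_closed compact_imp_closed finite_imp_compact_convex_hull) (simp add: finite_decoys)
  then have [measurable]: "Measurable.pred borel (\<lambda>w. w \<in> body S j)"
    by simp
  note f_measurable [measurable]
  show ?thesis
    unfolding extended_objective_def inst_simps by measurable
qed

text \<open>Yao's principle: the deterministic bound on the sum over instances holds for every seed,
  integration commutes with the finite sum, and some instance is at least as bad as the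
  average.\<close>

lemma expected_error_lower:
  assumes M: "randomized_method \<alpha> G (2 * N) P M"
    and calls: "\<And>\<omega> S j t. \<omega> \<in> space P \<Longrightarrow> S \<subseteq> {..<N} \<Longrightarrow> j < N \<Longrightarrow> projection_calls (M \<omega>) (inst S j) t \<le> T"
    and T: "3 * (T + 1) \<le> N" "4 * (2 * N) ^ T \<le> 2 ^ N"
  obtains S j where "S \<subseteq> {..<N}" "j < N"
    "ennreal (G\<^sup>2 / (128 * \<alpha> * real N)) \<le> expected_error P M (inst S j) (apex j)"
proof (rule ccontr)
  assume "\<not> thesis"
  let ?A = "Pow {..<N} \<times> {..<N}" and ?E = "\<lambda>(S, j). expected_error P M (inst S j) (apex j)"
  define e where "e = G\<^sup>2 / (128 * \<alpha> * real N)"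
  have less: "?E p < ennreal e" if "p \<in> ?A" for p
    using \<open>\<not> thesis\<close> that \<open>\<And>j S. S \<subseteq> {..<N} \<Longrightarrow> j < N \<Longrightarrow> _ \<Longrightarrow> thesis\<close>
    by (force simp: e_def not_le[symmetric])
  interpret prob_space P
    using M by (simp add: randomized_method_def)
  have meas: "(\<lambda>\<omega>. error (M \<omega>) S j) \<in> borel_measurable P" if "j < N" for S j
  proof -
    note extended_objective_measurable [measurable]
    have [measurable]: "(\<lambda>\<omega>. the_output (M \<omega>) (inst S j)) \<in> borel_measurable P"
      using M problem_instance_inst[OF that, of S] unfolding randomized_method_def by blast
    show ?thesis
      unfolding error_def by measurable
  qed
  have "({}, 0) \<in> ?A"
    using N_ge by simp
  then have fin: "finite ?A" and ne: "?A \<noteq> {}"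
    by (simp, blast)
  \<comment> \<open>Being strictly below \<open>ennreal e\<close>, the maximum is a finite real
    \<open>r\<close>, and the final comparison takes place among reals.\<close>
  define b where "b = Max (?E ` ?A)"
  have "b < ennreal e"
    unfolding b_def using fin ne less by (subst Max_less_iff) auto
  then obtain r where r: "b = ennreal r" "0 \<le> r" "r < e"
    by (cases b) (auto simp: ennreal_less_iff)
  have "ennreal (2 ^ N * real N * e) = (\<integral>\<^sup>+ \<omega>. ennreal (2 ^ N * real N * e) \<partial>P)"
    by (simp add: emeasure_space_1)
  also have "\<dots> \<le> (\<integral>\<^sup>+ \<omega>. (\<Sum>(S, j)\<in>?A. error (M \<omega>) S j) \<partial>P)"
    unfolding e_def using calls T by (intro nn_integral_mono sum_error_lower) auto
  also have "\<dots> = (\<Sum>p\<in>?A. ?E p)"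
    unfolding split_def expected_error_def error_def[symmetric]
    by (rule nn_integral_sum) (auto intro: meas)
  also have "\<dots> \<le> (\<Sum>p\<in>?A. b)"
    unfolding b_def using fin by (intro sum_mono Max_ge) auto
  also have "\<dots> = ennreal (2 ^ N * real N * r)"
    using r(2) by (simp add: r(1) card_Pow card_cartesian_product ennreal_mult ennreal_of_nat_eq_real_of_nat)
  finally have "2 ^ N * real N * e \<le> 2 ^ N * real N * r"
    using r(2) by (simp add: ennreal_le_iff)
  then show False
    using r(3) N_ge by simp
qed

end

section \<open>Query budgets\<close>

lemma budget_bounds:
  assumes "8 \<le> N" "real T \<le> real N / (128 * ln (2 * real N))"
  shows "3 * (T + 1) \<le> N" "4 * (2 * N) ^ T \<le> 2 ^ N"
proof -
  define L where "L = ln (2 * real N)"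
  have "exp 1 \<le> 2 * real N"
    using exp_le assms(1) by linarith
  then have L: "1 \<le> L"
    using assms(1) by (simp add: L_def ln_ge_iff)
  have TL: "real T * L \<le> real N / 128"
    using assms(2) L unfolding L_def[symmetric] by (simp add: field_simps)
  have "real T * 1 \<le> real T * L"
    using L by (intro mult_left_mono) auto
  with TL have "real T \<le> real N / 128"
    by simp
  then show "3 * (T + 1) \<le> N"
    using assms(1) by simp
  have "(2 * real N) ^ T = exp (real T * L)"
    using assms(1) by (simp add: L_def exp_of_nat_mult)
  then have "4 * (2 * real N) ^ T = exp (2 * ln 2) * exp (real T * L)"
    using exp_of_nat_mult[of 2 "ln 2 :: real"] by simp
  also have "\<dots> = exp (2 * ln 2 + real T * L)"
    by (simp add: exp_add)
  also have "\<dots> \<le> exp (real N * ln 2)"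
  proof -
    \<comment> \<open>What remains after the factor 4 = exp(2 ln 2) is (N - 2) ln 2, which exceeds
      N/128 for N at least 8.\<close>
    have "(real N - 2) * (2 / 3) \<le> (real N - 2) * ln 2"
      using assms(1) ln2_ge_two_thirds by (intro mult_left_mono) auto
    moreover have "8 \<le> real N"
      using assms(1) by simp
    ultimately have "2 * ln 2 + real N / 128 \<le> real N * ln 2"
      unfolding left_diff_distrib by linarith
    with TL show ?thesis
      by simp
  qed
  also have "\<dots> = 2 ^ N"
    by (simp add: exp_of_nat_mult)
  finally have "real (4 * (2 * N) ^ T) \<le> real (2 ^ N)"
    by simp
  then show "4 * (2 * N) ^ T \<le> 2 ^ N"
    by (simp only: of_nat_le_iff)
qed

lemma few_projections_error:
  fixes \<alpha> G :: real and N :: nat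
  assumes "0 < \<alpha>" "0 < G" "8 \<le> N" "randomized_method \<alpha> G (2 * N) P M"
    and "\<And>I wstar \<omega> t. problem_instance \<alpha> G (2 * N) I wstar \<Longrightarrow> \<omega> \<in> space P \<Longrightarrow>
      int (projection_calls (M \<omega>) I t) \<le> \<lfloor>real N / (128 * ln (2 * real N))\<rfloor>"
  shows "\<exists>I wstar. problem_instance \<alpha> G (2 * N) I wstar \<and>
    ennreal (G\<^sup>2 / (128 * \<alpha> * real N)) \<le> expected_error P M I wstar"
proof -
  interpret hard_family \<alpha> G N
    using assms by unfold_locales
  define T where "T = nat \<lfloor>real N / (128 * ln (2 * real N))\<rfloor>"
  have "0 \<le> real N / (128 * ln (2 * real N))"
    using assms(3) by simp
  then have "real T \<le> real N / (128 * ln (2 * real N))"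
    by (simp add: T_def)
  note T = budget_bounds[OF assms(3) this]
  have "projection_calls (M \<omega>) (inst S j) t \<le> T" if "\<omega> \<in> space P" "j < N" for \<omega> S j t
    using assms(5)[OF problem_instance_inst[OF that(2)] that(1), of S t] unfolding T_def by linarith
  then obtain S j where "j < N" "ennreal (G\<^sup>2 / (128 * \<alpha> * real N)) \<le> expected_error P M (inst S j) (apex j)"
    using expected_error_lower[OF assms(4) _ T] by metis
  then show ?thesis
    using problem_instance_inst by blast
qed

text \<open>The dimension is chosen so that the error forced by \<open>few_projections_error\<close>
  just exceeds the allowed one; hence the method must break the budget on some instance.\<close>

lemma accurate_method_projections:
  fixes \<alpha> G \<epsilon> :: real
  assumes pos: "0 < \<alpha>" "0 < G" "0 < \<epsilon>" and large: "2560 \<le> G\<^sup>2 / (\<alpha> * \<epsilon>)"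
    and M: "\<And>N. 8 \<le> N \<Longrightarrow> randomized_method \<alpha> G (2 * N) (P N) (M N)"
    and acc: "\<And>N I wstar. 8 \<le> N \<Longrightarrow> problem_instance \<alpha> G (2 * N) I wstar \<Longrightarrow>
      expected_error (P N) (M N) I wstar \<le> ennreal \<epsilon>"
  shows "\<exists>N\<ge>8. \<exists>I wstar. problem_instance \<alpha> G (2 * N) I wstar \<and>
    (\<exists>\<omega>\<in>space (P N). \<exists>t. 1 / 32768 * (G\<^sup>2 / (\<alpha> * \<epsilon> * ln (2 * G\<^sup>2 / (\<alpha> * \<epsilon>))))
      \<le> real (projection_calls (M N \<omega>) I t))"
proof (rule ccontr)
  assume few: "\<not> ?thesis"
  define Q where "Q = G\<^sup>2 / (\<alpha> * \<epsilon>)"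
  \<comment> \<open>The largest integer strictly below \<open>Q / 128\<close>; strictness makes
    G^2/(128 alpha N) larger than the allowed error.\<close>
  define N where "N = nat \<lceil>Q / 128\<rceil> - 1"
  have Q: "2560 \<le> Q"
    using large by (simp add: Q_def)
  then have "real (nat \<lceil>Q / 128\<rceil>) = of_int \<lceil>Q / 128\<rceil>" "1 \<le> nat \<lceil>Q / 128\<rceil>"
    by linarith+
  then have "real N = of_int \<lceil>Q / 128\<rceil> - 1"
    by (simp add: N_def of_nat_diff)
  then have N: "real N < Q / 128" "Q / 256 \<le> real N" "8 \<le> N"
    using Q by linarith+
  \<comment> \<open>Here 32768 = 256 * 128: one factor from \<open>N\<close> being at least
    \<open>Q / 256\<close>, the other from the budget.\<close>
  have "1 / 32768 * (Q / ln (2 * Q)) = Q / 256 / (128 * ln (2 * Q))"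
    by simp
  also have "\<dots> \<le> real N / (128 * ln (2 * Q))"
    using N Q by (intro divide_right_mono) auto
  also have "\<dots> \<le> real N / (128 * ln (2 * real N))"
    using N Q by (intro divide_left_mono) auto
  finally have *: "1 / 32768 * (Q / ln (2 * Q)) \<le> real N / (128 * ln (2 * real N))" .
  have "int (projection_calls (M N \<omega>) I t) \<le> \<lfloor>real N / (128 * ln (2 * real N))\<rfloor>"
    if "problem_instance \<alpha> G (2 * N) I wstar" "\<omega> \<in> space (P N)" for I wstar \<omega> t
  proof -
    have "real (projection_calls (M N \<omega>) I t) < 1 / 32768 * (G\<^sup>2 / (\<alpha> * \<epsilon> * ln (2 * G\<^sup>2 / (\<alpha> * \<epsilon>))))"
      using few that N(3) by (meson not_le)
    also have "\<dots> = 1 / 32768 * (Q / ln (2 * Q))"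
      by (simp add: Q_def)
    finally show ?thesis
      using * by (simp add: le_floor_iff)
  qed
  then obtain I wstar where I: "problem_instance \<alpha> G (2 * N) I wstar"
    "ennreal (G\<^sup>2 / (128 * \<alpha> * real N)) \<le> expected_error (P N) (M N) I wstar"
    using few_projections_error[OF pos(1,2) N(3) M[OF N(3)]] by blast
  have "ennreal (G\<^sup>2 / (128 * \<alpha> * real N)) \<le> ennreal \<epsilon>"
    using I(2) acc[OF N(3) I(1)] by (rule order_trans)
  then have "G\<^sup>2 / (128 * \<alpha> * real N) \<le> \<epsilon>"
    using pos by (simp add: ennreal_le_iff)
  then have "Q \<le> 128 * real N"
    using pos N(3) by (simp add: Q_def field_simps)
  then show False
    using N(1) by simp
qed

theorem theorem5:
  shows "(\<forall>(\<alpha>::real) (G::real) (N::nat) P M.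
      \<alpha> > 0 \<longrightarrow> G > 0 \<longrightarrow> N \<ge> 8 \<longrightarrow>
      randomized_method \<alpha> G (2 * N) P M \<longrightarrow>
      (\<forall>I wstar. problem_instance \<alpha> G (2 * N) I wstar \<longrightarrow>
        (\<forall>\<omega>\<in>space P. \<forall>t. int (projection_calls (M \<omega>) I t)
          \<le> \<lfloor>real N / (128 * ln (2 * real N))\<rfloor>)) \<longrightarrow>
      (\<exists>I wstar. problem_instance \<alpha> G (2 * N) I wstar \<and>
        expected_error P M I wstar \<ge> ennreal (G\<^sup>2 / (128 * \<alpha> * real N))))
    \<and>
    (\<exists>c0>0. \<exists>R0::real. \<forall>(\<alpha>::real) (G::real) (\<epsilon>::real) P M.
      \<alpha> > 0 \<longrightarrow> G > 0 \<longrightarrow> \<epsilon> > 0 \<longrightarrow> G\<^sup>2 / (\<alpha> * \<epsilon>) \<ge> R0 \<longrightarrow>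
      (\<forall>N\<ge>8. randomized_method \<alpha> G (2 * N) (P N) (M N)) \<longrightarrow>
      (\<forall>N\<ge>8. \<forall>I wstar. problem_instance \<alpha> G (2 * N) I wstar \<longrightarrow>
        expected_error (P N) (M N) I wstar \<le> ennreal \<epsilon>) \<longrightarrow>
      (\<exists>N\<ge>8. \<exists>I wstar. problem_instance \<alpha> G (2 * N) I wstar \<and>
        (\<exists>\<omega>\<in>space (P N). \<exists>t. real (projection_calls (M N \<omega>) I t)
          \<ge> c0 * (G\<^sup>2 / (\<alpha> * \<epsilon> * ln (2 * G\<^sup>2 / (\<alpha> * \<epsilon>)))))))"
proof (rule conjI)
  show "\<exists>c0>0. \<exists>R0::real. \<forall>(\<alpha>::real) (G::real) (\<epsilon>::real) P M.
      \<alpha> > 0 \<longrightarrow> G > 0 \<longrightarrow> \<epsilon> > 0 \<longrightarrow> G\<^sup>2 / (\<alpha> * \<epsilon>) \<ge> R0 \<longrightarrow>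
      (\<forall>N\<ge>8. randomized_method \<alpha> G (2 * N) (P N) (M N)) \<longrightarrow>
      (\<forall>N\<ge>8. \<forall>I wstar. problem_instance \<alpha> G (2 * N) I wstar \<longrightarrow>
        expected_error (P N) (M N) I wstar \<le> ennreal \<epsilon>) \<longrightarrow>
      (\<exists>N\<ge>8. \<exists>I wstar. problem_instance \<alpha> G (2 * N) I wstar \<and>
        (\<exists>\<omega>\<in>space (P N). \<exists>t. real (projection_calls (M N \<omega>) I t)
          \<ge> c0 * (G\<^sup>2 / (\<alpha> * \<epsilon> * ln (2 * G\<^sup>2 / (\<alpha> * \<epsilon>))))))"
    by (intro exI[of _ "1 / 32768"] conjI exI[of _ 2560] allI impI accurate_method_projections) auto
qed (use few_projections_error in blast)

end
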